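(* Let $n\ge 0$. A function $g\colon \operatorname{AdS}_n\to\mathbb{Z}$ is the rank function $g_D$ of some delta-matroid $D$ on $[n,\overline{n}]$ if and only if all of the following hold: (1) $g(\emptyset)=0$; (2) $|g(S)|\le 1$ for every $S\in\operatorname{AdS}_n$ with $|S|=1$; (3) $g(S)+g(T)\ge g(S\cap T)+g(S\sqcup T)$ for all $S,T\in\operatorname{AdS}_n$; (4) $g(S)\equiv |S| \pmod 2$ for all $S\in\operatorname{AdS}_n$. Furthermore, a delta-matroid $D$ on $[n,\overline{n}]$ is even if and only if $$g_D(S)=\frac{g_D(S\cup\{i\})+g_D(S\cup\{\overline{i}\})}{2}$$ for every $S\in\operatorname{AdS}_n$ with $|S|=n-1$ and every $i\in[n]$ with $\{i,\overline{i}\}\cap S=\emptyset$.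
   Context: Let $[n,\overline{n}]=\{1,\dots,n,\overline{1},\dots,\overline{n}\}$ with the involution $a\mapsto\overline{a}$ (so $\overline{\overline{a}}=a$); for a set $S$ write $\overline{S}=\{\overline{a}:a\in S\}$. A subset $S\subseteq[n,\overline{n}]$ is admissible if it contains at most one of $i,\overline{i}$ for each $i\in[n]$; $\operatorname{AdS}_n$ is the set of admissible subsets. For $S,T\in\operatorname{AdS}_n$, $S\sqcup T=\{a\in S\cup T:\overline{a}\notin S\cup T\}$. In $\mathbb{R}^n$ with standard basis $e_1,\dots,e_n$, set $e_{\overline{i}}=-e_i$ and $e_S=\sum_{a\in S}e_a$. A delta-matroid $D$ on $[n,\overline{n}]$ is a nonempty collection $\mathcal{F}\subseteq\operatorname{AdS}_n$ of admissible sets of size $n$ (the feasible sets) such that the polytope $P(D)=\operatorname{Conv}\{e_B:B\in\mathcal{F}\}$ has every edge parallel to $e_i$ or to $e_i\pm e_j$ for some $i,j$. $D$ is even if every edge of $P(D)$ is parallel to some $e_i\pm e_j$. The rank function of $D$ is $g_D\colon\operatorname{AdS}_n\to\mathbb{Z}$, $g_D(S)=\max_{B\in\mathcal{F}}(|S\cap B|-|\overline{S}\cap B|)$. *)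

theory Defs
  imports "HOL-Analysis.Analysis"
begin

text \<open>The ground set [n] is a finite set E of indices of a finite type 'a
  (n = card E); signed elements of [n, n-bar] are pairs (i, b) with
  (i, True) standing for i and (i, False) for its bar.  Vectors live in
  real^'a, with e_i = axis i 1.\<close>

definition bar :: "'a \<times> bool \<Rightarrow> 'a \<times> bool" where
  "bar a = (fst a, \<not> snd a)"

definition barS :: "('a \<times> bool) set \<Rightarrow> ('a \<times> bool) set" where
  "barS S = bar ` S"

definition AdS :: "'a set \<Rightarrow> ('a \<times> bool) set set" where
  "AdS E = {S. S \<subseteq> E \<times> UNIV \<and> (\<forall>i. \<not> ((i, True) \<in> S \<and> (i, False) \<in> S))}"

definition sqcup :: "('a \<times> bool) set \<Rightarrow> ('a \<times> bool) set \<Rightarrow> ('a \<times> bool) set" where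
  "sqcup S T = {a \<in> S \<union> T. bar a \<notin> S \<union> T}"

definition evec :: "'a::finite \<times> bool \<Rightarrow> real ^ 'a" where
  "evec a = (if snd a then axis (fst a) 1 else - axis (fst a) 1)"

definition eS :: "('a::finite \<times> bool) set \<Rightarrow> real ^ 'a" where
  "eS S = (\<Sum>a\<in>S. evec a)"

definition polytope_of :: "('a::finite \<times> bool) set set \<Rightarrow> (real ^ 'a) set" where
  "polytope_of F = convex hull (eS ` F)"

definition is_edge :: "(real ^ 'a::finite) set \<Rightarrow> (real ^ 'a) set \<Rightarrow> bool" where
  "is_edge P e \<longleftrightarrow> e face_of P \<and> aff_dim e = 1"

definition parallel_to :: "(real ^ 'a::finite) set \<Rightarrow> real ^ 'a \<Rightarrow> bool" where
  "parallel_to e v \<longleftrightarrow> (\<forall>x\<in>e. \<forall>y\<in>e. \<exists>c::real. x - y = c *\<^sub>R v)"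

definition dm_dirs :: "'a::finite set \<Rightarrow> (real ^ 'a) set" where
  "dm_dirs E = {axis i 1 | i. i \<in> E}
     \<union> {axis i 1 + axis j 1 | i j. i \<in> E \<and> j \<in> E \<and> i \<noteq> j}
     \<union> {axis i 1 - axis j 1 | i j. i \<in> E \<and> j \<in> E \<and> i \<noteq> j}"

definition even_dirs :: "'a::finite set \<Rightarrow> (real ^ 'a) set" where
  "even_dirs E = {axis i 1 + axis j 1 | i j. i \<in> E \<and> j \<in> E \<and> i \<noteq> j}
     \<union> {axis i 1 - axis j 1 | i j. i \<in> E \<and> j \<in> E \<and> i \<noteq> j}"

definition delta_matroid :: "'a::finite set \<Rightarrow> ('a \<times> bool) set set \<Rightarrow> bool" where
  "delta_matroid E F \<longleftrightarrow> F \<noteq> {} \<and> F \<subseteq> AdS E \<and> (\<forall>B\<in>F. card B = card E) \<and>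
     (\<forall>e. is_edge (polytope_of F) e \<longrightarrow> (\<exists>v\<in>dm_dirs E. parallel_to e v))"

definition even_dm :: "'a::finite set \<Rightarrow> ('a \<times> bool) set set \<Rightarrow> bool" where
  "even_dm E F \<longleftrightarrow> delta_matroid E F \<and>
     (\<forall>e. is_edge (polytope_of F) e \<longrightarrow> (\<exists>v\<in>even_dirs E. parallel_to e v))"

definition dm_rank :: "('a \<times> bool) set set \<Rightarrow> ('a \<times> bool) set \<Rightarrow> int" where
  "dm_rank F S = Max ((\<lambda>B. int (card (S \<inter> B)) - int (card (barS S \<inter> B))) ` F)"

end

theory Submission
  imports Defs
begin

text \<open>If every edge of the polytope changes at most two indices, then for admissible
  \<open>X \<subseteq> Y\<close> a vertex maximising \<open>eS X + eS Y\<close> maximises both summands. Applied to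
  \<open>S \<inter> T \<subseteq> sqcup S T\<close>, this gives the inequality (3), because
  \<open>eS S + eS T = eS (S \<inter> T) + eS (sqcup S T)\<close>.

  Conversely, given \<open>g\<close>, call a full set \<open>B\<close> feasible if \<open>eS S \<bullet> eS B \<le> g S\<close> for all
  admissible \<open>S\<close>. The greedy algorithm along a chain of admissible sets makes increments
  \<open>\<plusminus>1\<close>, by (2), (3) and parity, and so produces a feasible set that is tight along the chain.
  Tightness yields an exchange property for feasible sets, and the exchange property forces the
  two ends of an edge to differ in at most two indices.

  In an even delta-matroid all feasible sets are connected by exchanges of two indices, so
  \<open>eS M \<bullet> eS B\<close> modulo 4 does not depend on the feasible set \<open>B\<close> when \<open>M\<close> is full. Hence
  \<open>g\<close> takes different values at \<open>S \<union> {i}\<close> and \<open>S \<union> {bar i}\<close> if \<open>S\<close> misses only the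
  index \<open>i\<close>.\<close>

section \<open>Signed sets\<close>

lemma bar_bar [simp]: "bar (bar a) = a"
  by (simp add: bar_def)

lemma fst_bar [simp]: "fst (bar a) = fst a"
  by (simp add: bar_def)

lemma bar_neq [simp]: "bar a \<noteq> a"
  by (cases a) (auto simp: bar_def)

lemma bar_eq_iff [simp]: "bar a = bar b \<longleftrightarrow> a = b"
  by (metis bar_bar)

lemma inj_on_bar [simp]: "inj_on bar A"
  by (simp add: inj_on_def)

lemma same_fstD: "fst a = fst b \<Longrightarrow> a = b \<or> a = bar b"
  by (cases a; cases b) (auto simp: bar_def)

lemma bar_in_Times [simp]: "bar a \<in> E \<times> UNIV \<longleftrightarrow> a \<in> E \<times> UNIV"
  by (cases a) (auto simp: bar_def)

lemma mem_image_bar [simp]: "a \<in> bar ` S \<longleftrightarrow> bar a \<in> S"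
proof
  assume "bar a \<in> S"
  then have "bar (bar a) \<in> bar ` S" by (rule imageI)
  then show "a \<in> bar ` S" by simp
qed (auto simp del: split_paired_All split_paired_Ex)

text \<open>Phrased through \<open>bar\<close>, admissibility is symmetric in the two signs, so
  later arguments avoid case distinctions on the sign.\<close>

lemma AdS_iff: "S \<in> AdS E \<longleftrightarrow> S \<subseteq> E \<times> UNIV \<and> (\<forall>a\<in>S. bar a \<notin> S)"
proof -
  have "(\<forall>a\<in>S. bar a \<notin> S) \<longleftrightarrow> (\<forall>i. \<not> ((i, True) \<in> S \<and> (i, False) \<in> S))"
  proof
    assume R: "\<forall>i. \<not> ((i, True) \<in> S \<and> (i, False) \<in> S)"
    have "bar (i, b) \<notin> S" if "(i, b) \<in> S" for i b
      using R that by (cases b) (auto simp: bar_def)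
    then show "\<forall>a\<in>S. bar a \<notin> S" by auto
  next
    assume "\<forall>a\<in>S. bar a \<notin> S"
    then have "bar (i, True) \<notin> S" if "(i, True) \<in> S" for i
      using that by blast
    then show "\<forall>i. \<not> ((i, True) \<in> S \<and> (i, False) \<in> S)"
      by (simp add: bar_def)
  qed
  then show ?thesis by (simp add: AdS_def)
qed

lemma AdS_subset: "T \<in> AdS E \<Longrightarrow> S \<subseteq> T \<Longrightarrow> S \<in> AdS E"
  unfolding AdS_iff by blast

lemma inj_on_fst_AdS: "S \<in> AdS E \<Longrightarrow> inj_on fst S"
  unfolding AdS_iff by (intro inj_onI) (use same_fstD in blast)

text \<open>Under \<open>eS\<close> these correspond to the vertices of the cube with coordinates 1
  and -1 on \<open>E\<close>; every member of a delta-matroid is of this kind.\<close>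

definition full_sets :: "'a set \<Rightarrow> ('a \<times> bool) set set" where
  "full_sets E = {B \<in> AdS E. card B = card E}"

lemma full_setsD_AdS: "B \<in> full_sets E \<Longrightarrow> B \<in> AdS E"
  by (simp add: full_sets_def)

text \<open>The map \<open>fst\<close> is injective on an admissible set, so having
  \<open>card E\<close> elements means that every index occurs, with exactly one sign.\<close>

lemma full_sets_iff:
  fixes E :: "'a::finite set"
  shows "B \<in> full_sets E \<longleftrightarrow> B \<subseteq> E \<times> UNIV \<and> (\<forall>a\<in>E \<times> UNIV. a \<in> B \<longleftrightarrow> bar a \<notin> B)"
    (is "?L \<longleftrightarrow> ?R")
proof
  assume L: ?L
  then have B: "B \<in> AdS E" "card B = card E" by (auto simp: full_sets_def)
  have sub: "fst ` B \<subseteq> E" using B(1) by (auto simp: AdS_iff)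
  have "card (fst ` B) = card E"
    using B(2) card_image[OF inj_on_fst_AdS[OF B(1)]] by simp
  then have img: "fst ` B = E" using sub by (simp add: card_subset_eq)
  have "a \<in> B \<longleftrightarrow> bar a \<notin> B" if "a \<in> E \<times> UNIV" for a
  proof -
    have "fst a \<in> fst ` B" using img that by (simp add: mem_Times_iff)
    then obtain b where "b \<in> B" "fst a = fst b" by blast
    then have "a \<in> B \<or> bar a \<in> B" using same_fstD[of a b] by auto
    then show ?thesis using B(1) unfolding AdS_iff by blast
  qed
  then show ?R using B(1) unfolding AdS_iff by blast
next
  assume R: ?R
  then have B: "B \<in> AdS E" unfolding AdS_iff by blast
  have "fst ` B = E"
  proof
    show "fst ` B \<subseteq> E" using conjunct1[OF R] by auto
    show "E \<subseteq> fst ` B"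
    proof
      fix i assume "i \<in> E"
      then have "(i, True) \<in> B \<or> bar (i, True) \<in> B" using R by blast
      then show "i \<in> fst ` B" by (metis fst_bar fst_conv image_eqI)
    qed
  qed
  then have "card B = card E" using card_image[OF inj_on_fst_AdS[OF B]] by simp
  then show ?L using B by (simp add: full_sets_def)
qed

lemma full_sets_bar:
  fixes E :: "'a::finite set"
  shows "B \<in> full_sets E \<Longrightarrow> a \<in> E \<times> UNIV \<Longrightarrow> bar a \<in> B \<longleftrightarrow> a \<notin> B"
  unfolding full_sets_iff by blast

lemma AdS_extend_full:
  fixes E :: "'a::finite set"
  assumes "Y \<in> AdS E"
  obtains N where "N \<in> full_sets E" "Y \<subseteq> N"
proof
  \<comment> \<open>Indices that do not occur in \<open>Y\<close> receive the positive sign.\<close>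
  let ?N = "Y \<union> {a \<in> E \<times> UNIV. snd a \<and> bar a \<notin> Y}"
  show "?N \<in> full_sets E"
    unfolding full_sets_iff
  proof (intro conjI ballI)
    fix a :: "'a \<times> bool" assume "a \<in> E \<times> UNIV"
    then show "a \<in> ?N \<longleftrightarrow> bar a \<notin> ?N"
      using assms unfolding AdS_iff by (cases "snd a") (auto simp: bar_def)
  qed (use assms in \<open>auto simp: AdS_iff\<close>)
qed auto

text \<open>Passing between full sets flips the sign at some indices, so each difference is the
  barred copy of the other. The size of a difference thus counts the flipped indices.\<close>

lemma full_sets_diff_bar:
  fixes E :: "'a::finite set"
  assumes "B \<in> full_sets E" "B' \<in> full_sets E"
  shows "B - B' = bar ` (B' - B)"
proof -
  have iff: "a \<in> B - B' \<longleftrightarrow> bar a \<in> B' - B" for a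
  proof (cases "a \<in> E \<times> UNIV")
    case True
    then show ?thesis using full_sets_bar[OF assms(1)] full_sets_bar[OF assms(2)] by auto
  next
    case False
    moreover have "B \<subseteq> E \<times> UNIV" "B' \<subseteq> E \<times> UNIV"
      using assms by (simp_all add: full_sets_def AdS_def)
    ultimately show ?thesis by (metis DiffD1 bar_in_Times subsetD)
  qed
  show ?thesis by (rule set_eqI) (simp only: mem_image_bar iff)
qed

lemma full_sets_diff_card:
  fixes E :: "'a::finite set"
  assumes "B \<in> full_sets E" "B' \<in> full_sets E"
  shows "card (B - B') = card (B' - B)"
  using full_sets_diff_bar[OF assms] by (simp add: card_image)

lemma full_sets_diff_nonempty:
  fixes E :: "'a::finite set"
  assumes "B \<in> full_sets E" "B' \<in> full_sets E" "B \<noteq> B'"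
  shows "B' - B \<noteq> {}"
  using full_sets_diff_bar[OF assms(1,2)] assms(3) by auto

section \<open>The pairing of signed sets\<close>

definition sg :: "('a \<times> bool) set \<Rightarrow> 'a \<times> bool \<Rightarrow> int" where
  "sg B a = of_bool (a \<in> B) - of_bool (bar a \<in> B)"

text \<open>This is the inner product of \<open>eS S\<close> and \<open>eS B\<close>, kept in
  \<open>int\<close> so that parity and residues modulo 4 can be used.\<close>

definition pairing :: "('a \<times> bool) set \<Rightarrow> ('a \<times> bool) set \<Rightarrow> int" where
  "pairing S B = (\<Sum>a\<in>S. sg B a)"

lemma sg_bar: "sg B (bar a) = - sg B a"
  by (simp add: sg_def)

lemma sg_full:
  fixes E :: "'a::finite set"
  shows "B \<in> full_sets E \<Longrightarrow> a \<in> E \<times> UNIV \<Longrightarrow> sg B a = (if a \<in> B then 1 else -1)"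
  by (auto simp: sg_def full_sets_bar)

lemma pairing_card:
  fixes S :: "('a::finite \<times> bool) set"
  shows "pairing S B = int (card (S \<inter> B)) - int (card (barS S \<inter> B))"
proof -
  have "barS S \<inter> B = bar ` {a \<in> S. bar a \<in> B}"
    unfolding barS_def by (rule set_eqI) simp
  then have "card (barS S \<inter> B) = card {a \<in> S. bar a \<in> B}" by (simp add: card_image)
  moreover have "S \<inter> B = {a \<in> S. a \<in> B}" by auto
  ultimately show ?thesis
    by (simp add: pairing_def sg_def sum_subtractf of_bool_def sum.If_cases Int_def)
qed

lemma dm_rank_pairing:
  fixes F :: "('a::finite \<times> bool) set set"
  shows "dm_rank F S = Max (pairing S ` F)"
  by (simp add: dm_rank_def pairing_card[abs_def])

lemma pairing_le_dm_rank:
  fixes F :: "('a::finite \<times> bool) set set"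
  shows "B \<in> F \<Longrightarrow> pairing S B \<le> dm_rank F S"
  by (simp add: dm_rank_pairing)

lemma dm_rank_attained:
  fixes F :: "('a::finite \<times> bool) set set"
  assumes "F \<noteq> {}"
  obtains B where "B \<in> F" "dm_rank F S = pairing S B"
proof -
  have "Max (pairing S ` F) \<in> pairing S ` F" using assms by (intro Max_in) auto
  then show ?thesis using that by (auto simp: dm_rank_pairing)
qed

text \<open>Against a full set every element of \<open>S\<close> contributes 1 or -1. This yields
  the parity of the rank as well as the cardinality bounds below.\<close>

lemma pairing_full:
  fixes E :: "'a::finite set"
  assumes "B \<in> full_sets E" "S \<subseteq> E \<times> UNIV"
  shows "pairing S B = int (card S) - 2 * int (card (S - B))"
proof -
  have "pairing S B = (\<Sum>a\<in>S. 1 - 2 * of_bool (a \<notin> B))"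
    unfolding pairing_def
    using sg_full[OF assms(1) subsetD[OF assms(2)]] by (intro sum.cong refl) simp
  also have "\<dots> = int (card S) - 2 * (\<Sum>a\<in>S. of_bool (a \<notin> B))"
    by (simp add: sum_subtractf sum_distrib_left)
  also have "(\<Sum>a\<in>S. of_bool (a \<notin> B)) = int (card (S - B))"
    by (simp add: of_bool_def sum.If_cases set_diff_eq Int_def)
  finally show ?thesis .
qed

lemma pairing_insert:
  fixes S :: "('a::finite \<times> bool) set"
  shows "a \<notin> S \<Longrightarrow> pairing (insert a S) B = sg B a + pairing S B"
  by (simp add: pairing_def)

text \<open>For a function that is odd under \<open>bar\<close>, the elements of the union whose bar
  is also present cancel in pairs. Hence \<open>sqcup S T\<close> may replace the union in
  inclusion-exclusion.\<close>

lemma sum_Int_sqcup: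
  fixes y :: "'a::finite \<times> bool \<Rightarrow> int"
  assumes "\<And>a. y (bar a) = - y a"
  shows "sum y S + sum y T = sum y (S \<inter> T) + sum y (sqcup S T)"
proof -
  let ?W = "{a \<in> S \<union> T. bar a \<in> S \<union> T}"
  have "bar ` ?W = ?W" by (rule set_eqI) (simp add: conj_commute)
  then have "sum y ?W = sum (y \<circ> bar) ?W"
    using sum.reindex[of bar ?W y] by simp
  also have "\<dots> = - sum y ?W" by (simp add: assms sum_negf)
  finally have W: "sum y ?W = 0" by simp
  have "S \<union> T = sqcup S T \<union> ?W" "sqcup S T \<inter> ?W = {}" by (auto simp: sqcup_def)
  then have "sum y (S \<union> T) = sum y (sqcup S T)"
    using W sum.union_disjoint[of "sqcup S T" ?W y] by (simp only: finite)
  then show ?thesis using sum.union_inter[of S T y] by simp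
qed

lemma pairing_Int_sqcup:
  fixes S :: "('a::finite \<times> bool) set"
  shows "pairing S B + pairing T B = pairing (S \<inter> T) B + pairing (sqcup S T) B"
  unfolding pairing_def by (rule sum_Int_sqcup) (rule sg_bar)

section \<open>The vectors of signed sets\<close>

lemma evec_bar: "evec (bar a) = - evec a"
  by (simp add: evec_def bar_def)

lemma evec_nth: "evec a $ i = (if fst a = i then if snd a then 1 else -1 else 0)"
  by (simp add: evec_def axis_def)

lemma evec_inner: "evec a \<bullet> x = (if snd a then x $ fst a else - x $ fst a)"
  by (simp add: evec_def inner_axis')

lemma eS_nth: "eS B $ i = sg B (i, True)"
proof -
  have "eS B $ i = (\<Sum>b\<in>B. of_bool (b = (i, True)) - of_bool (b = (i, False)))"
    unfolding eS_def sum_component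
    by (intro sum.cong refl) (auto simp: evec_nth)
  also have "\<dots> = sg B (i, True)"
    by (simp add: sum_subtractf sg_def of_bool_def bar_def)
  finally show ?thesis .
qed

lemma evec_inner_eS: "evec a \<bullet> eS B = sg B a"
proof (cases a)
  case (Pair i b)
  then show ?thesis
    using sg_bar[of B "(i, True)"] by (cases b) (simp_all add: evec_inner eS_nth bar_def)
qed

lemma eS_inner_eS: "eS S \<bullet> eS B = pairing S B"
  by (simp add: eS_def[of S] inner_sum_left evec_inner_eS pairing_def)

text \<open>Common elements cancel. The elements of \<open>B - B'\<close> are the bars of those of
  \<open>B' - B\<close>, so subtracting them adds the same vector once more.\<close>

lemma eS_diff_eq:
  fixes E :: "'a::finite set"
  assumes "B \<in> full_sets E" "B' \<in> full_sets E"
  shows "eS B' - eS B = 2 *\<^sub>R eS (B' - B)"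
proof -
  have "eS B' = eS (B' \<inter> B) + eS (B' - B)" "eS B = eS (B' \<inter> B) + eS (B - B')"
    unfolding eS_def by (metis finite sum.Int_Diff, metis finite sum.Int_Diff Int_commute)
  moreover have "eS (B - B') = - eS (B' - B)"
    unfolding full_sets_diff_bar[OF assms] eS_def
    by (simp add: sum.reindex evec_bar sum_negf)
  ultimately show ?thesis by (simp add: scaleR_2)
qed

lemma eS_nth_neq_iff:
  fixes E :: "'a::finite set"
  assumes "B \<in> full_sets E" "B' \<in> full_sets E"
  shows "eS B' $ i \<noteq> eS B $ i \<longleftrightarrow> i \<in> fst ` (B' - B)"
proof (cases "i \<in> E")
  case True
  have s: "(i, False) \<in> C \<longleftrightarrow> (i, True) \<notin> C" if "C \<in> full_sets E" for C
    using full_sets_bar[OF that, of "(i, True)"] True by (simp add: bar_def)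
  have "i \<in> fst ` (B' - B) \<longleftrightarrow> (\<exists>b. (i, b) \<in> B' - B)"
    by force
  also have "\<dots> \<longleftrightarrow> (i, True) \<in> B' - B \<or> (i, False) \<in> B' - B"
    by (simp add: ex_bool_eq disj_commute)
  finally have "i \<in> fst ` (B' - B) \<longleftrightarrow> (i, True) \<in> B' - B \<or> (i, False) \<in> B' - B" .
  then show ?thesis
    by (simp add: eS_nth sg_def bar_def s[OF assms(1)] s[OF assms(2)] of_bool_def)
next
  case False
  then have "i \<notin> fst ` B'" "i \<notin> fst ` B"
    using full_setsD_AdS[OF assms(1)] full_setsD_AdS[OF assms(2)] by (auto simp: AdS_def)
  moreover have "eS C $ i = 0" if "i \<notin> fst ` C" for C
    using that by (auto simp: eS_nth sg_def bar_def image_iff)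
  ultimately show ?thesis by auto
qed

lemma eS_inj_full:
  fixes E :: "'a::finite set"
  assumes "B \<in> full_sets E" "B' \<in> full_sets E" "eS B' = eS B"
  shows "B' = B"
  using eS_nth_neq_iff[OF assms(1,2)] full_sets_diff_nonempty[OF assms(1,2)] assms(3)
  by auto

section \<open>Edges\<close>

text \<open>The hyperplane section of the cone at \<open>v0\<close> (its vertex figure) is the convex hull of the
  points \<open>p v\<close> below. Its extreme points span the edges at \<open>v0\<close>, and one of them
  must be improving since the points \<open>p v\<close> are not all contained in \<open>u \<bullet> x \<le> 0\<close>.\<close>

lemma improving_edge_at_vertex:
  fixes V :: "'b::euclidean_space set"
  assumes fin: "finite V" and v0: "v0 \<in> V"
    and w: "\<And>v. v \<in> V \<Longrightarrow> v \<noteq> v0 \<Longrightarrow> w \<bullet> v < w \<bullet> v0"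
    and v1: "v1 \<in> V" "u \<bullet> v0 < u \<bullet> v1"
  obtains v e where "v \<in> V" "u \<bullet> v0 < u \<bullet> v" "v0 \<in> e" "v \<in> e"
    "e face_of convex hull V" "aff_dim e = 1"
proof -
  \<comment> \<open>The number \<open>s v\<close> is the depth of \<open>v\<close> below
    \<open>v0\<close> in direction \<open>w\<close>. Dividing by it places all \<open>p v\<close> on
    the hyperplane \<open>w \<bullet> x = -1\<close>.\<close>
  define s where "s v = w \<bullet> v0 - w \<bullet> v" for v
  define p where "p v = (v - v0) /\<^sub>R s v" for v
  have s_pos: "s v > 0" if "v \<in> V" "v \<noteq> v0" for v
    using w[OF that] by (simp add: s_def)
  have diff: "v - v0 = s v *\<^sub>R p v" if "v \<in> V" "v \<noteq> v0" for v
    using s_pos[OF that] by (simp add: p_def)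
  define Q where "Q = convex hull (p ` (V - {v0}))"
  have finp: "finite (p ` (V - {v0}))" using fin by simp
  have "\<exists>q. q extreme_point_of Q \<and> u \<bullet> q > 0"
  proof (rule ccontr)
    assume "\<nexists>q. q extreme_point_of Q \<and> u \<bullet> q > 0"
    then have "{x. x extreme_point_of Q} \<subseteq> {x. u \<bullet> x \<le> 0}" by (auto simp: not_less)
    then have "convex hull {x. x extreme_point_of Q} \<subseteq> {x. u \<bullet> x \<le> 0}"
      by (rule hull_minimal) (rule convex_halfspace_le)
    moreover have "convex hull {x. x extreme_point_of Q} = Q"
      unfolding Q_def using Krein_Milman_polytope[OF finp] by simp
    moreover have "v1 \<noteq> v0" using v1 by auto
    then have "p v1 \<in> Q" unfolding Q_def using v1 by (intro hull_inc) auto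
    ultimately have "u \<bullet> p v1 \<le> 0" by auto
    moreover have "u \<bullet> v1 - u \<bullet> v0 = s v1 * (u \<bullet> p v1)"
      using diff[OF v1(1) \<open>v1 \<noteq> v0\<close>] by (metis inner_diff_right inner_scaleR_right)
    ultimately show False
      using v1 s_pos[OF v1(1) \<open>v1 \<noteq> v0\<close>] by (smt (verit) mult_nonneg_nonpos)
  qed
  then obtain q where q: "q extreme_point_of Q" "u \<bullet> q > 0" by blast
  obtain v where v: "v \<in> V" "v \<noteq> v0" "q = p v"
    using extreme_point_of_convex_hull q(1) unfolding Q_def by blast
  have "{q} face_of Q" using q(1) by (simp add: face_of_singleton)
  moreover have "polyhedron Q"
    unfolding Q_def using finp polytope_def polytope_imp_polyhedron by blast
  ultimately have "{q} exposed_face_of Q" using exposed_face_of_polyhedron by blast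
  then obtain z c where z: "Q \<subseteq> {x. z \<bullet> x \<le> c}" "{q} = Q \<inter> {x. z \<bullet> x = c}"
    unfolding exposed_face_of_def by blast
  \<comment> \<open>Since \<open>w \<bullet> p x = -1\<close>, adding \<open>c *\<^sub>R w\<close>
    lowers the value at each \<open>p x\<close> by \<open>c\<close>. The functional exposing
    \<open>q\<close> in \<open>Q\<close> thus becomes one that is maximal at \<open>v0\<close> and,
    elsewhere in \<open>V\<close>, only at points \<open>x\<close> with
    \<open>p x = q\<close>.\<close>
  define z' where "z' = z + c *\<^sub>R w"
  have z'_diff: "z' \<bullet> x - z' \<bullet> v0 = s x * (z \<bullet> p x - c)" if "x \<in> V" "x \<noteq> v0" for x
  proof -
    have "z' \<bullet> x - z' \<bullet> v0 = z \<bullet> (x - v0) - c * s x"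
      by (simp add: z'_def s_def inner_add_left inner_diff_right right_diff_distrib)
    then show ?thesis by (simp add: diff[OF that] right_diff_distrib)
  qed
  have pQ: "p x \<in> Q" if "x \<in> V" "x \<noteq> v0" for x
    unfolding Q_def using that by (intro hull_inc) auto
  have z'_le: "z' \<bullet> x \<le> z' \<bullet> v0" if "x \<in> V" for x
  proof (cases "x = v0")
    case False
    have "z \<bullet> p x \<le> c" using z(1) pQ[OF that False] by auto
    then have "s x * (z \<bullet> p x - c) \<le> 0"
      using s_pos[OF that False] by (simp add: mult_nonneg_nonpos)
    then show ?thesis using z'_diff[OF that False] by simp
  qed simp
  have z'_eq: "x \<in> affine hull {v0, v}" if x: "x \<in> V" "z' \<bullet> x = z' \<bullet> v0" for x
  proof (cases "x = v0")
    case True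
    then show ?thesis by (simp add: hull_inc)
  next
    case False
    have "z \<bullet> p x = c" using z'_diff[OF x(1) False] x s_pos[OF x(1) False] by simp
    then have "p x = q" using z(2) pQ[OF x(1) False] by auto
    then have "x = v0 + (s x / s v) *\<^sub>R (v - v0)"
      using diff[OF x(1) False] diff[OF v(1,2)] v(3) s_pos[OF v(1,2)]
      by (metis (no_types, lifting) add.commute diff_add_cancel divide_inverse less_irrefl
          nonzero_eq_divide_eq scaleR_scaleR)
    then show ?thesis by (auto simp: affine_hull_2_alt)
  qed
  define e where "e = convex hull V \<inter> {x. z' \<bullet> x = z' \<bullet> v0}"
  have "convex hull V \<subseteq> {x. z' \<bullet> x \<le> z' \<bullet> v0}"
    using z'_le by (intro hull_minimal) (auto simp: convex_halfspace_le)
  then have face: "e face_of convex hull V"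
    unfolding e_def by (intro face_of_Int_supporting_hyperplane_le) auto
  have "z \<bullet> q = c" using z(2) by auto
  then have "z' \<bullet> v = z' \<bullet> v0" using z'_diff[OF v(1,2)] v(3) by simp
  then have mem: "v0 \<in> e" "v \<in> e" using v0 v by (auto simp: e_def hull_inc)
  \<comment> \<open>The face is the hull of points of \<open>V\<close>, and those in the face lie on
    the line through \<open>v0\<close> and \<open>v\<close>; this bounds its dimension.\<close>
  obtain V' where V': "V' \<subseteq> V" "e = convex hull V'"
    using face_of_convex_hull_subset[OF finite_imp_compact[OF fin] face] by blast
  have "V' \<subseteq> e" using V'(2) by (simp add: hull_subset)
  then have "V' \<subseteq> affine hull {v0, v}" using z'_eq V'(1) by (auto simp: e_def)
  then have "e \<subseteq> affine hull {v0, v}"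
    unfolding V'(2) by (intro hull_minimal) (simp_all add: affine_imp_convex)
  then have "aff_dim e \<le> 1"
    using aff_dim_subset[of e "affine hull {v0, v}"] v by (simp split: if_splits)
  moreover have "aff_dim e \<ge> 1"
    using aff_dim_subset[of "{v0, v}" e] mem v by (simp split: if_splits)
  moreover have "u \<bullet> v - u \<bullet> v0 = s v * (u \<bullet> q)"
    using diff[OF v(1,2)] v(3) by (metis inner_diff_right inner_scaleR_right)
  then have "u \<bullet> v0 < u \<bullet> v" using s_pos[OF v(1,2)] q(2) by (smt (verit) mult_pos_pos)
  ultimately show ?thesis using that v(1) mem face by force
qed

text \<open>Among vectors of full sets, \<open>eS B\<close> has its largest inner product with
  itself only, so each \<open>eS B\<close> is a vertex with supporting functional
  \<open>eS B\<close>. As in the simplex method, a vertex that is not optimal for \<open>u\<close>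
  has an improving edge.\<close>

lemma improving_edge:
  fixes E :: "'a::finite set"
  assumes F: "F \<subseteq> full_sets E" and "B \<in> F" "B0 \<in> F" and "u \<bullet> eS B < u \<bullet> eS B0"
  obtains B' e where "B' \<in> F" "u \<bullet> eS B < u \<bullet> eS B'" "eS B \<in> e" "eS B' \<in> e"
    "is_edge (polytope_of F) e"
proof -
  have "eS B \<bullet> v < eS B \<bullet> eS B" if "v \<in> eS ` F" "v \<noteq> eS B" for v
  proof -
    from that obtain C where C: "C \<in> F" "v = eS C" by blast
    then have full: "B \<in> full_sets E" "C \<in> full_sets E" and "B \<noteq> C" using F assms that by auto
    then have "card (B - C) > 0"
      using full_sets_diff_nonempty[of C E B] by (simp add: card_gt_0_iff)
    moreover have "B \<subseteq> E \<times> UNIV" using full by (simp add: full_sets_def AdS_def)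
    ultimately have "pairing B C < pairing B B"
      using full by (simp add: pairing_full)
    then show ?thesis by (simp add: C eS_inner_eS)
  qed
  then show ?thesis
    using improving_edge_at_vertex[of "eS ` F" "eS B" "eS B" "eS B0" u] assms that
    unfolding is_edge_def polytope_of_def by (smt (verit, best) finite finite_imageI imageE imageI)
qed

section \<open>Supports and directions of differences\<close>

lemma fst_diff_eq_support:
  fixes E :: "'a::finite set"
  assumes "B \<in> full_sets E" "B' \<in> full_sets E"
  shows "fst ` (B' - B) = {i. (eS B' - eS B) $ i \<noteq> 0}"
  using eS_nth_neq_iff[OF assms] by auto

lemma card_diff_eq_support:
  fixes E :: "'a::finite set"
  assumes "B \<in> full_sets E" "B' \<in> full_sets E"
  shows "card (B' - B) = card {i. (eS B' - eS B) $ i \<noteq> 0}"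
proof -
  have "inj_on fst (B' - B)"
    by (rule inj_on_fst_AdS[OF AdS_subset[OF full_setsD_AdS[OF assms(2)]]]) auto
  then show ?thesis
    unfolding fst_diff_eq_support[OF assms, symmetric] by (simp add: card_image)
qed

lemma dm_dirs_support: "v \<in> dm_dirs E \<Longrightarrow> card {i. v $ i \<noteq> 0} \<le> 2"
proof -
  assume "v \<in> dm_dirs E"
  then obtain i j where "{k. v $ k \<noteq> 0} \<subseteq> {i, j}"
    unfolding dm_dirs_def by (force simp: axis_def split: if_splits)
  then have "card {k. v $ k \<noteq> 0} \<le> card {i, j}" by (intro card_mono) auto
  also have "\<dots> \<le> 2" by (simp add: card_insert_if)
  finally show ?thesis .
qed

lemma even_dirs_support: "v \<in> even_dirs E \<Longrightarrow> card {i. v $ i \<noteq> 0} = 2"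
proof -
  assume "v \<in> even_dirs E"
  then obtain i j where "i \<noteq> j" "v = axis i 1 + axis j 1 \<or> v = axis i 1 - axis j 1"
    unfolding even_dirs_def by blast
  moreover from this have "{k. v $ k \<noteq> 0} = {i, j}"
    by (auto simp: axis_def split: if_splits)
  ultimately show ?thesis by simp
qed

lemma even_dirs_subset: "even_dirs E \<subseteq> dm_dirs E"
  unfolding even_dirs_def dm_dirs_def by blast

text \<open>The flipped indices form the support of the difference vector, and a multiple of
  \<open>v\<close> has its support inside that of \<open>v\<close>.\<close>

lemma card_diff_le_2_if_parallel:
  fixes E :: "'a::finite set"
  assumes "B \<in> full_sets E" "B' \<in> full_sets E" "eS B \<in> e" "eS B' \<in> e"
    and "v \<in> dm_dirs E" "parallel_to e v"
  shows "card (B' - B) \<le> 2"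
proof -
  obtain c where "eS B' - eS B = c *\<^sub>R v" using assms unfolding parallel_to_def by blast
  then have "{i. (eS B' - eS B) $ i \<noteq> 0} \<subseteq> {i. v $ i \<noteq> 0}" by auto
  then show ?thesis
    using card_diff_eq_support[OF assms(1,2)] dm_dirs_support[OF assms(5)]
    by (metis card_mono finite le_trans)
qed

text \<open>Distinct full sets have distinct vectors, so the factor is non-zero and the two supports
  coincide.\<close>

lemma card_diff_eq_2_if_parallel:
  fixes E :: "'a::finite set"
  assumes "B \<in> full_sets E" "B' \<in> full_sets E" "eS B \<in> e" "eS B' \<in> e"
    and "v \<in> even_dirs E" "parallel_to e v" "B \<noteq> B'"
  shows "card (B' - B) = 2"
proof -
  obtain c where c: "eS B' - eS B = c *\<^sub>R v" using assms unfolding parallel_to_def by blast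
  moreover have "c \<noteq> 0" using c eS_inj_full[OF assms(1,2)] assms(7) by auto
  ultimately have "{i. (eS B' - eS B) $ i \<noteq> 0} = {i. v $ i \<noteq> 0}" by simp
  then show ?thesis
    using card_diff_eq_support[OF assms(1,2)] even_dirs_support[OF assms(5)] by simp
qed

lemma eS_diff_dm_dirs:
  fixes E :: "'a::finite set"
  assumes "B \<in> full_sets E" "B' \<in> full_sets E" "card (B' - B) = 1"
  obtains v k where "v \<in> dm_dirs E" "eS B' - eS B = k *\<^sub>R v"
proof -
  obtain a where a: "B' - B = {a}" using assms(3) by (auto simp: card_1_singleton_iff)
  have "fst a \<in> E" using a full_setsD_AdS[OF assms(2)] by (auto simp: AdS_def)
  then have "axis (fst a) 1 \<in> dm_dirs E" by (auto simp: dm_dirs_def)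
  moreover have "eS B' - eS B = (if snd a then 2 else -2) *\<^sub>R axis (fst a) 1"
    using eS_diff_eq[OF assms(1,2)] a by (simp add: eS_def evec_def)
  ultimately show ?thesis using that by blast
qed

lemma eS_diff_even_dirs:
  fixes E :: "'a::finite set"
  assumes "B \<in> full_sets E" "B' \<in> full_sets E" "card (B' - B) = 2"
  obtains v k where "v \<in> even_dirs E" "eS B' - eS B = k *\<^sub>R v"
proof -
  obtain a b where ab: "B' - B = {a, b}" "a \<noteq> b" using assms(3) by (auto simp: card_2_iff)
  have B': "B' \<in> AdS E" by (rule full_setsD_AdS[OF assms(2)])
  have mem: "a \<in> B'" "b \<in> B'" using ab by auto
  then have E: "fst a \<in> E" "fst b \<in> E" using B' by (auto simp: AdS_def)
  have ne: "fst a \<noteq> fst b" using inj_on_fst_AdS[OF B'] mem ab(2) by (auto dest: inj_onD)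
  let ?v = "if snd a = snd b then axis (fst a) 1 + axis (fst b) 1
            else axis (fst a) 1 - axis (fst b) 1 :: real ^ 'a"
  have "?v \<in> even_dirs E" using E ne by (auto simp: even_dirs_def)
  moreover have "eS B' - eS B = (if snd a then 2 else -2) *\<^sub>R ?v"
    using eS_diff_eq[OF assms(1,2)] ab by (auto simp: eS_def evec_def algebra_simps)
  ultimately show ?thesis using that by blast
qed

text \<open>A face of a polytope is the hull of some of its generators and is exposed. The first
  fact supplies two members of \<open>F\<close> spanning the direction of the edge, the second a
  functional \<open>u\<close> whose maximisers form the edge.\<close>

lemma edge_vertices:
  fixes E :: "'a::finite set"
  assumes F: "F \<subseteq> full_sets E" and edge: "is_edge (polytope_of F) e"
  obtains B B' u where "B \<in> F" "B' \<in> F" "B \<noteq> B'" "eS B \<in> e" "eS B' \<in> e"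
    "\<And>x y. x \<in> e \<Longrightarrow> y \<in> e \<Longrightarrow> \<exists>c. x - y = c *\<^sub>R (eS B' - eS B)"
    "u \<bullet> eS B' = u \<bullet> eS B" "\<And>C. C \<in> F \<Longrightarrow> u \<bullet> eS C \<le> u \<bullet> eS B"
    "\<And>C. C \<in> F \<Longrightarrow> u \<bullet> eS C = u \<bullet> eS B \<Longrightarrow> eS C \<in> e"
proof -
  have face: "e face_of convex hull (eS ` F)" and dim: "aff_dim e = 1"
    using edge by (auto simp: is_edge_def polytope_of_def)
  obtain V where V: "V \<subseteq> eS ` F" "e = convex hull V"
    using face_of_convex_hull_subset[OF finite_imp_compact face] by auto
  have dimV: "aff_dim V = 1" using dim V(2) by (simp add: aff_dim_convex_hull)
  have "V \<noteq> {}" using dimV by auto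
  then obtain x where x: "x \<in> V" by blast
  have "V \<noteq> {x}" using dimV by auto
  then obtain y where y: "y \<in> V" "y \<noteq> x" using x by blast
  have xy: "x \<in> e" "y \<in> e" using x y V(2) by (auto simp: hull_inc)
  obtain B B' where B: "B \<in> F" "x = eS B" "B' \<in> F" "y = eS B'" using x y V(1) by blast
  have "collinear e" using dim by (simp add: collinear_aff_dim)
  then obtain w where w: "\<And>p q. p \<in> e \<Longrightarrow> q \<in> e \<Longrightarrow> \<exists>c. p - q = c *\<^sub>R w"
    unfolding collinear_def by blast
  obtain c0 where c0: "y - x = c0 *\<^sub>R w" using w xy by blast
  then have "c0 \<noteq> 0" using y(2) by auto
  have par: "\<exists>c. p - q = c *\<^sub>R (eS B' - eS B)" if pq: "p \<in> e" "q \<in> e" for p q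
  proof -
    obtain c where "p - q = c *\<^sub>R w" using w[OF pq] by blast
    then have "p - q = (c / c0) *\<^sub>R (eS B' - eS B)" using c0 \<open>c0 \<noteq> 0\<close> B by simp
    then show ?thesis by blast
  qed
  have "finite (eS ` F)" by simp
  then have "polyhedron (convex hull (eS ` F))"
    by (intro polytope_imp_polyhedron) (auto simp only: polytope_def)
  then have "e exposed_face_of convex hull (eS ` F)"
    using exposed_face_of_polyhedron face by blast
  then obtain u b where u: "convex hull (eS ` F) \<subseteq> {x. u \<bullet> x \<le> b}"
    "e = convex hull (eS ` F) \<inter> {x. u \<bullet> x = b}"
    unfolding exposed_face_of_def by blast
  have hull: "eS C \<in> convex hull (eS ` F)" if "C \<in> F" for C using that by (simp add: hull_inc)
  show ?thesis
  proof (rule that[of B B' u])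
    show "\<exists>c. p - q = c *\<^sub>R (eS B' - eS B)" if "p \<in> e" "q \<in> e" for p q
      by (rule par[OF that])
    have b: "u \<bullet> eS B = b" "u \<bullet> eS B' = b" using u(2) xy B by auto
    then show "u \<bullet> eS B' = u \<bullet> eS B" by simp
    fix C assume "C \<in> F"
    then show "u \<bullet> eS C \<le> u \<bullet> eS B" using u(1) hull b by auto
    show "eS C \<in> e" if "u \<bullet> eS C = u \<bullet> eS B" using u(2) hull \<open>C \<in> F\<close> b that by auto
  qed (use B xy y in auto)
qed

lemma parallel_to_multiple:
  assumes "\<And>x y. x \<in> e \<Longrightarrow> y \<in> e \<Longrightarrow> \<exists>c. x - y = c *\<^sub>R d" "d = k *\<^sub>R v"
  shows "parallel_to e v"
  using assms unfolding parallel_to_def by (metis scaleR_scaleR)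

section \<open>The rank function of a delta-matroid\<close>

lemma delta_matroid_full: "delta_matroid E F \<Longrightarrow> F \<subseteq> full_sets E"
  by (auto simp: delta_matroid_def full_sets_def)

lemma sqcup_AdS: "S \<in> AdS E \<Longrightarrow> T \<in> AdS E \<Longrightarrow> sqcup S T \<in> AdS E"
  unfolding AdS_iff sqcup_def by blast

lemma sqcup_eq_Un:
  assumes "S \<union> T \<in> AdS E" shows "sqcup S T = S \<union> T"
  using assms unfolding AdS_iff sqcup_def by blast

lemma Int_subset_sqcup: "S \<in> AdS E \<Longrightarrow> T \<in> AdS E \<Longrightarrow> S \<inter> T \<subseteq> sqcup S T"
  unfolding AdS_iff sqcup_def by blast

text \<open>The elements of \<open>G\<close> counted by \<open>X\<close> are counted by
  \<open>Y\<close> with the same sign, and \<open>Y\<close> counts at most two in all. A plus in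
  \<open>X\<close> therefore leaves room for at most one minus in \<open>Y\<close>; a positive total
  in \<open>Y\<close> leaves room for no minus.\<close>

lemma pairing_small:
  fixes G :: "('a::finite \<times> bool) set"
  assumes "X \<subseteq> Y" "Y \<in> AdS E" "card G \<le> 2"
  shows "pairing X G > 0 \<Longrightarrow> pairing Y G \<ge> 0" "pairing Y G > 0 \<Longrightarrow> pairing X G \<ge> 0"
proof -
  have 1: "card (X \<inter> G) \<le> card (Y \<inter> G)" "card (barS X \<inter> G) \<le> card (barS Y \<inter> G)"
    using assms(1) unfolding barS_def by (auto intro!: card_mono)
  have "(Y \<inter> G) \<inter> (barS Y \<inter> G) = {}"
    using assms(2) unfolding AdS_iff barS_def by (auto simp del: split_paired_All)
  then have "card (Y \<inter> G) + card (barS Y \<inter> G) = card ((Y \<inter> G) \<union> (barS Y \<inter> G))"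
    by (simp add: card_Un_disjoint)
  also have "\<dots> \<le> card G" by (intro card_mono) auto
  finally have 2: "card (Y \<inter> G) + card (barS Y \<inter> G) \<le> 2" using assms(3) by simp
  show "pairing X G > 0 \<Longrightarrow> pairing Y G \<ge> 0" "pairing Y G > 0 \<Longrightarrow> pairing X G \<ge> 0"
    using 1 2 unfolding pairing_card by linarith+
qed

lemma pairing_diff:
  fixes E :: "'a::finite set"
  assumes "B \<in> full_sets E" "B' \<in> full_sets E"
  shows "pairing X B' - pairing X B = 2 * pairing X (B' - B)"
proof -
  have "eS X \<bullet> (eS B' - eS B) = 2 * (eS X \<bullet> eS (B' - B))"
    by (simp add: eS_diff_eq[OF assms])
  then have "real_of_int (pairing X B' - pairing X B) = real_of_int (2 * pairing X (B' - B))"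
    by (simp add: inner_diff_right eS_inner_eS)
  then show ?thesis by (simp only: of_int_eq_iff)
qed

text \<open>A maximiser of \<open>eS X + eS Y\<close> maximises both summands: along an edge, that is, along a
  difference of at most two indices, neither can increase while the other decreases.\<close>

lemma common_maximiser:
  fixes E :: "'a::finite set"
  assumes dm: "delta_matroid E F" and XY: "X \<subseteq> Y" "Y \<in> AdS E"
  obtains B where "B \<in> F" "dm_rank F X = pairing X B" "dm_rank F Y = pairing Y B"
proof -
  have F: "F \<subseteq> full_sets E" "F \<noteq> {}"
    using dm delta_matroid_full by (auto simp: delta_matroid_def)
  let ?f = "\<lambda>B. pairing X B + pairing Y B"
  have "Max (?f ` F) \<in> ?f ` F" using F(2) by (intro Max_in) auto
  then obtain B where B: "B \<in> F" "?f B = Max (?f ` F)" by auto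
  have max: "?f B' \<le> ?f B" if "B' \<in> F" for B' using that B(2) by simp
  \<comment> \<open>A set that is not a maximiser has an improving edge, and an edge of a
    delta-matroid flips at most two indices.\<close>
  have improve: "\<exists>B'\<in>F. pairing S B' > pairing S B \<and> card (B' - B) \<le> 2"
    if "pairing S B < dm_rank F S" for S
  proof -
    obtain B0 where B0: "B0 \<in> F" "dm_rank F S = pairing S B0" using dm_rank_attained[OF F(2)] .
    then have "eS S \<bullet> eS B < eS S \<bullet> eS B0" using that by (simp add: eS_inner_eS)
    from improving_edge[OF F(1) B(1) B0(1) this] obtain B' e where B':
      "B' \<in> F" "eS S \<bullet> eS B < eS S \<bullet> eS B'" "eS B \<in> e" "eS B' \<in> e"
      "is_edge (polytope_of F) e" .
    obtain v where "v \<in> dm_dirs E" "parallel_to e v"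
      using dm B'(5) unfolding delta_matroid_def by blast
    then have "card (B' - B) \<le> 2"
      using card_diff_le_2_if_parallel[of B E B' e v] B B' F(1) by blast
    then show ?thesis using B' by (auto simp: eS_inner_eS)
  qed
  have "\<not> pairing X B < dm_rank F X"
  proof
    assume "pairing X B < dm_rank F X"
    then obtain B' where B': "B' \<in> F" "pairing X B' > pairing X B" "card (B' - B) \<le> 2"
      using improve by blast
    have d: "pairing S B' - pairing S B = 2 * pairing S (B' - B)" for S
      using pairing_diff B(1) B'(1) F(1) by blast
    show False
      using pairing_small(1)[OF XY B'(3)] d[of X] d[of Y] B'(2) max[OF B'(1)] by linarith
  qed
  moreover have "\<not> pairing Y B < dm_rank F Y"
  proof
    assume "pairing Y B < dm_rank F Y"
    then obtain B' where B': "B' \<in> F" "pairing Y B' > pairing Y B" "card (B' - B) \<le> 2"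
      using improve by blast
    have d: "pairing S B' - pairing S B = 2 * pairing S (B' - B)" for S
      using pairing_diff B(1) B'(1) F(1) by blast
    show False
      using pairing_small(2)[OF XY B'(3)] d[of X] d[of Y] B'(2) max[OF B'(1)] by linarith
  qed
  ultimately show ?thesis
    using that[OF B(1)] pairing_le_dm_rank[OF B(1), of X] pairing_le_dm_rank[OF B(1), of Y]
    by linarith
qed

text \<open>One set \<open>B\<close> attains both terms on the right. Its pairings satisfy the
  relation with equality, and those with \<open>S\<close> and \<open>T\<close> are bounded by the
  ranks.\<close>

lemma dm_rank_bisubmodular:
  fixes E :: "'a::finite set"
  assumes dm: "delta_matroid E F" and ST: "S \<in> AdS E" "T \<in> AdS E"
  shows "dm_rank F S + dm_rank F T \<ge> dm_rank F (S \<inter> T) + dm_rank F (sqcup S T)"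
proof -
  obtain B where B: "B \<in> F" "dm_rank F (S \<inter> T) = pairing (S \<inter> T) B"
    "dm_rank F (sqcup S T) = pairing (sqcup S T) B"
    using common_maximiser[OF dm Int_subset_sqcup[OF ST] sqcup_AdS[OF ST]] .
  then show ?thesis
    using pairing_Int_sqcup[of S B T] pairing_le_dm_rank[OF B(1), of S]
      pairing_le_dm_rank[OF B(1), of T] by linarith
qed

lemma dm_rank_parity:
  fixes E :: "'a::finite set"
  assumes "F \<subseteq> full_sets E" "F \<noteq> {}" "S \<in> AdS E"
  shows "dm_rank F S mod 2 = int (card S) mod 2"
proof -
  obtain B where "B \<in> F" "dm_rank F S = pairing S B" using dm_rank_attained[OF assms(2)] .
  moreover have "S \<subseteq> E \<times> UNIV" using assms(3) by (simp add: AdS_def)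
  ultimately have "dm_rank F S = int (card S) - 2 * int (card (S - B))"
    using assms(1) pairing_full[of B E S] by auto
  then show ?thesis by presburger
qed

lemma dm_rank_empty:
  fixes F :: "('a::finite \<times> bool) set set"
  shows "F \<noteq> {} \<Longrightarrow> dm_rank F {} = 0"
  by (erule dm_rank_attained[where S = "{}"]) (simp add: pairing_def)

lemma dm_rank_abs_le:
  fixes E :: "'a::finite set"
  assumes "F \<subseteq> full_sets E" "F \<noteq> {}" "S \<in> AdS E"
  shows "\<bar>dm_rank F S\<bar> \<le> int (card S)"
proof -
  obtain B where "B \<in> F" "dm_rank F S = pairing S B" using dm_rank_attained[OF assms(2)] .
  moreover have "S \<subseteq> E \<times> UNIV" using assms(3) by (simp add: AdS_def)
  moreover have "card (S - B) \<le> card S" by (intro card_mono) auto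
  ultimately show ?thesis using assms(1) pairing_full[of B E S] by auto
qed

section \<open>Feasible sets from a rank function\<close>

locale signed_rank =
  fixes E :: "'a::finite set" and g :: "('a \<times> bool) set \<Rightarrow> int"
  assumes g_empty: "g {} = 0"
    and g_singleton: "\<And>S. S \<in> AdS E \<Longrightarrow> card S = 1 \<Longrightarrow> \<bar>g S\<bar> \<le> 1"
    and g_bisub: "\<And>S T. S \<in> AdS E \<Longrightarrow> T \<in> AdS E \<Longrightarrow> g S + g T \<ge> g (S \<inter> T) + g (sqcup S T)"
    and g_parity: "\<And>S. S \<in> AdS E \<Longrightarrow> g S mod 2 = int (card S) mod 2"
begin

text \<open>These are the full sets whose vectors lie in the bisubmodular polyhedron of
  \<open>g\<close>. Any delta-matroid with rank function \<open>g\<close> consists of such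
  sets.\<close>

definition feasible :: "('a \<times> bool) set set" where
  "feasible = {B \<in> full_sets E. \<forall>S\<in>AdS E. pairing S B \<le> g S}"

text \<open>Bisubmodularity of \<open>T\<close> with \<open>{a}\<close> bounds the increment by 1.
  Joining \<open>{bar a}\<close> to \<open>insert a T\<close> by \<open>sqcup\<close> removes
  \<open>a\<close> again, which bounds the increment below by -1. Parity excludes 0.\<close>

lemma g_insert_diff:
  assumes "a \<notin> T" "insert a T \<in> AdS E"
  shows "g (insert a T) - g T \<in> {1, -1}"
proof -
  have a: "bar a \<notin> T" "a \<in> E \<times> UNIV"
    using assms(2) unfolding AdS_iff by blast+
  have T: "T \<in> AdS E" using AdS_subset[OF assms(2)] by blast
  have sing: "{b} \<in> AdS E" if "b \<in> E \<times> UNIV" for b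
    using that bar_neq[of b] unfolding AdS_iff by simp
  have ad: "{a} \<in> AdS E" "{bar a} \<in> AdS E" using sing a(2) by simp_all
  have "sqcup T {a} = insert a T" using assms(2) by (simp add: sqcup_eq_Un)
  then have 1: "g T + g {a} \<ge> g {} + g (insert a T)"
    using g_bisub[OF T ad(1)] assms(1) by simp
  have "x \<in> sqcup (insert a T) {bar a} \<longleftrightarrow> x \<in> T" for x
    using assms a unfolding AdS_iff sqcup_def by (metis (mono_tags, lifting) Un_iff bar_bar
        insert_iff mem_Collect_eq singletonD)
  then have "sqcup (insert a T) {bar a} = T" by blast
  moreover have "insert a T \<inter> {bar a} = {}" using a(1) by simp
  ultimately have 2: "g (insert a T) + g {bar a} \<ge> g {} + g T"
    using g_bisub[OF assms(2) ad(2)] by simp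
  have "card (insert a T) = Suc (card T)" using assms(1) by simp
  then have "g (insert a T) mod 2 = (int (card T) + 1) mod 2" "g T mod 2 = int (card T) mod 2"
    using g_parity[OF assms(2)] g_parity[OF T] by (simp_all add: add.commute)
  then have "(g (insert a T) - g T) mod 2 = 1" by presburger
  moreover have "\<bar>g (insert a T) - g T\<bar> \<le> 1"
    using 1 2 g_empty g_singleton[OF ad(1)] g_singleton[OF ad(2)] by simp
  ultimately show ?thesis by simp presburger
qed

text \<open>A state of the greedy algorithm: a sign for each element of \<open>T\<close>, within the
  bounds on subsets and tight at \<open>T\<close>. Inside an admissible set \<open>sqcup\<close> is
  union, so this is the greedy algorithm for an ordinary submodular function.\<close>

definition greedy_on :: "('a \<times> bool) set \<Rightarrow> ('a \<times> bool \<Rightarrow> int) \<Rightarrow> bool" where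
  "greedy_on T y \<longleftrightarrow> (\<forall>a\<in>T. y a \<in> {1, -1}) \<and> (\<forall>U\<subseteq>T. sum y U \<le> g U) \<and> sum y T = g T"

text \<open>Tightness forces the new value. For \<open>U\<close> containing \<open>a\<close>,
  diminishing increments give that the step from \<open>T\<close> to \<open>insert a T\<close> is at
  most the step from \<open>U - {a}\<close> to \<open>U\<close>.\<close>

lemma greedy_on_insert:
  assumes y: "greedy_on T y" and a: "a \<notin> T" "insert a T \<in> AdS E"
  shows "greedy_on (insert a T) (y(a := g (insert a T) - g T))"
proof -
  let ?y = "y(a := g (insert a T) - g T)"
  have T: "T \<in> AdS E" using AdS_subset[OF a(2)] by blast
  have eq: "sum ?y U = sum y U" if "a \<notin> U" for U
    using that by (intro sum.cong) auto
  have "sum ?y U \<le> g U" if U: "U \<subseteq> insert a T" for U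
  proof (cases "a \<in> U")
    case False
    then show ?thesis using U y eq unfolding greedy_on_def by (simp add: subset_insert)
  next
    case True
    have "U \<union> T = insert a T" "U \<inter> T = U - {a}" using U True a by auto
    then have "g U + g T \<ge> g (U - {a}) + g (insert a T)"
      using g_bisub[OF AdS_subset[OF a(2) U] T] sqcup_eq_Un[of U T E] a(2) by simp
    moreover have "sum y (U - {a}) \<le> g (U - {a})"
      using y U unfolding greedy_on_def by (metis Diff_subset_conv Un_insert_left sup_bot_left)
    moreover have "sum ?y U = ?y a + sum y (U - {a})"
      using True eq[of "U - {a}"] by (simp add: sum.remove)
    ultimately show ?thesis by simp
  qed
  moreover have "sum ?y (insert a T) = g (insert a T)"
    using a(1) eq[OF a(1)] y by (simp add: greedy_on_def)
  moreover have "\<forall>b\<in>insert a T. ?y b \<in> {1, -1}"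
    using y g_insert_diff[OF a] unfolding greedy_on_def by auto
  ultimately show ?thesis unfolding greedy_on_def by blast
qed

lemma greedy_on_extend:
  assumes y: "greedy_on T y" and "T \<subseteq> T'" "T' \<in> AdS E"
  obtains y' where "greedy_on T' y'" "\<And>a. a \<in> T \<Longrightarrow> y' a = y a"
proof -
  have "\<exists>y'. greedy_on (T \<union> D) y' \<and> (\<forall>a\<in>T. y' a = y a)" if "finite D" "D \<subseteq> T' - T" for D
    using that
  proof (induction D rule: finite_induct)
    case empty
    then show ?case using y by auto
  next
    case (insert a D)
    then obtain y' where y': "greedy_on (T \<union> D) y'" "\<forall>a\<in>T. y' a = y a" by auto
    have "insert a (T \<union> D) \<in> AdS E"
      by (rule AdS_subset[OF assms(3)]) (use insert.prems assms(2) in auto)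
    then have "greedy_on (insert a (T \<union> D)) (y'(a := g (insert a (T \<union> D)) - g (T \<union> D)))"
      using greedy_on_insert[OF y'(1)] insert.hyps insert.prems by blast
    moreover have "\<forall>b\<in>T. (y'(a := g (insert a (T \<union> D)) - g (T \<union> D))) b = y b"
      using y'(2) insert.prems by auto
    ultimately show ?case by (metis Un_insert_right)
  qed
  from this[of "T' - T"] show ?thesis using that assms(2) by (auto simp: Un_absorb1)
qed

text \<open>For full \<open>N\<close>, both \<open>S \<inter> N\<close> and \<open>sqcup S N\<close>
  are subsets of \<open>N\<close>, where the bound is known. Tightness at \<open>N\<close> and
  bisubmodularity carry it over to every admissible \<open>S\<close>.\<close>

lemma feasibleI:
  assumes N: "N \<in> full_sets E" and y: "greedy_on N y"
  obtains B where "B \<in> feasible" "\<And>a. a \<in> N \<Longrightarrow> sg B a = y a"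
proof -
  have NA: "N \<in> AdS E" by (rule full_setsD_AdS[OF N])
  \<comment> \<open>An element of \<open>N\<close> is kept if its value is 1 and replaced by its bar
    otherwise.\<close>
  define B where "B = {a \<in> E \<times> UNIV. if a \<in> N then y a = 1 else y (bar a) \<noteq> 1}"
  have B: "B \<in> full_sets E"
    unfolding full_sets_iff
  proof (intro conjI ballI)
    fix a :: "'a \<times> bool" assume a: "a \<in> E \<times> UNIV"
    show "a \<in> B \<longleftrightarrow> bar a \<notin> B"
      using a full_sets_bar[OF N a] unfolding B_def by simp
  qed (auto simp: B_def)
  have sgB: "sg B a = y a" if "a \<in> N" for a
  proof -
    have "a \<in> E \<times> UNIV" using that NA by (auto simp: AdS_def)
    moreover have "y a \<in> {1, -1}" using y that unfolding greedy_on_def by blast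
    ultimately show ?thesis using that sg_full[OF B, of a] by (auto simp: B_def)
  qed
  have sub: "pairing U B \<le> g U" if "U \<subseteq> N" for U
  proof -
    have "pairing U B = sum y U" unfolding pairing_def using that sgB by (intro sum.cong) auto
    then show ?thesis using y that unfolding greedy_on_def by simp
  qed
  have "pairing N B = sum y N" unfolding pairing_def using sgB by (intro sum.cong) auto
  then have tight: "pairing N B = g N" using y unfolding greedy_on_def by simp
  have "pairing S B \<le> g S" if S: "S \<in> AdS E" for S
  proof -
    have "x \<in> N" if "x \<in> sqcup S N" for x
    proof -
      have "x \<in> E \<times> UNIV" using that S NA unfolding sqcup_def AdS_def by blast
      then show ?thesis using that full_sets_bar[OF N, of x] unfolding sqcup_def by blast
    qed
    then have "pairing (sqcup S N) B \<le> g (sqcup S N)" by (intro sub) blast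
    moreover have "pairing (S \<inter> N) B \<le> g (S \<inter> N)" by (intro sub) blast
    ultimately show ?thesis
      using g_bisub[OF S NA] pairing_Int_sqcup[of S B N] tight by linarith
  qed
  then have "B \<in> feasible" using B by (simp add: feasible_def)
  then show ?thesis using that sgB by blast
qed

text \<open>The greedy algorithm runs through \<open>X\<close>, \<open>Y\<close> and a full set
  \<open>N\<close> containing \<open>Y\<close>. Values once chosen never change, so tightness at
  \<open>X\<close> and \<open>Y\<close> survives to the end.\<close>

lemma feasible_tight:
  assumes XY: "X \<subseteq> Y" "Y \<in> AdS E"
  obtains B where "B \<in> feasible" "pairing X B = g X" "pairing Y B = g Y"
proof -
  obtain N where N: "N \<in> full_sets E" "Y \<subseteq> N" using AdS_extend_full[OF XY(2)] .
  have NA: "N \<in> AdS E" by (rule full_setsD_AdS[OF N(1)])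
  have "greedy_on {} (\<lambda>_. 0)" using g_empty by (simp add: greedy_on_def)
  then obtain y0 where y0: "greedy_on X y0"
    using greedy_on_extend[of "{}" _ X] AdS_subset[OF XY(2,1)] by blast
  obtain y1 where y1: "greedy_on Y y1" "\<And>a. a \<in> X \<Longrightarrow> y1 a = y0 a"
    using greedy_on_extend[OF y0 XY] by blast
  obtain y where y: "greedy_on N y" "\<And>a. a \<in> Y \<Longrightarrow> y a = y1 a"
    using greedy_on_extend[OF y1(1) N(2) NA] by blast
  obtain B where B: "B \<in> feasible" "\<And>a. a \<in> N \<Longrightarrow> sg B a = y a"
    using feasibleI[OF N(1) y(1)] by blast
  have "pairing Y B = sum y1 Y"
    unfolding pairing_def by (rule sum.cong[OF refl]) (metis B(2) N(2) subsetD y(2))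
  moreover have "pairing X B = sum y0 X"
    unfolding pairing_def by (rule sum.cong[OF refl]) (metis B(2) N(2) XY(1) subsetD y(2) y1(2))
  ultimately show ?thesis using that B(1) y0 y1(1) unfolding greedy_on_def by simp
qed

section \<open>The feasible sets form a delta-matroid with rank function \<open>g\<close>\<close>

lemma feasible_full: "feasible \<subseteq> full_sets E"
  by (auto simp: feasible_def)

lemma feasible_nonempty: "feasible \<noteq> {}"
proof -
  have "{} \<in> AdS E" by (simp add: AdS_def)
  then show ?thesis using feasible_tight[of "{}" "{}"] by blast
qed

lemma dm_rank_feasible:
  assumes "S \<in> AdS E" shows "dm_rank feasible S = g S"
proof -
  obtain B where B: "B \<in> feasible" "pairing S B = g S" using feasible_tight[OF order_refl assms] .
  obtain C where C: "C \<in> feasible" "dm_rank feasible S = pairing S C"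
    using dm_rank_attained[OF feasible_nonempty] .
  have "pairing S C \<le> g S" using C(1) assms by (simp add: feasible_def)
  then show ?thesis using pairing_le_dm_rank[OF B(1), of S] B(2) C(2) by simp
qed

text \<open>A feasible set that is tight at \<open>insert a (B \<inter> B')\<close> and at \<open>insert a (B - {bar a})\<close>
  contains the first set and, by parity, misses at most one element of the second.\<close>

lemma feasible_exchange:
  assumes B: "B \<in> feasible" "B' \<in> feasible" and a: "a \<in> B' - B"
  obtains C where "C \<in> feasible" "a \<in> C" "C - B \<subseteq> B' - B" "card (C - B) \<le> 2"
proof -
  have full: "B \<in> full_sets E" "B' \<in> full_sets E" using B by (auto simp: feasible_def)
  have ad: "B \<in> AdS E" "B' \<in> AdS E" using full by (auto simp: full_sets_def)
  have aE: "a \<in> E \<times> UNIV" using a ad by (auto simp: AdS_def)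
  have bara: "bar a \<in> B" "bar a \<notin> B'" using full_sets_bar[OF _ aE] full a by auto
  define X where "X = insert a (B \<inter> B')"
  define M where "M = insert a (B - {bar a})"
  have sub: "X \<subseteq> M" using bara by (auto simp: X_def M_def)
  have M: "M \<in> AdS E"
    using ad(1) aE unfolding AdS_iff M_def by (metis (no_types, lifting) Diff_iff bar_bar bar_neq
        insert_iff insert_subset subset_Diff_insert subset_iff)
  obtain C where C: "C \<in> feasible" "pairing X C = g X" "pairing M C = g M"
    using feasible_tight[OF sub M] .
  have fullC: "C \<in> full_sets E" using C(1) by (simp add: feasible_def)
  have E: "M \<subseteq> E \<times> UNIV" "X \<subseteq> E \<times> UNIV" using M sub by (auto simp: AdS_def)
  \<comment> \<open>Since \<open>X\<close> is contained in \<open>B'\<close>, the value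
    \<open>g X\<close> is at least \<open>card X\<close>, so the tight set \<open>C\<close> contains
    all of \<open>X\<close>.\<close>
  have "pairing X B' \<le> g X"
    using B(2) AdS_subset[OF M sub] by (simp add: feasible_def)
  moreover have "X - B' = {}" using a by (auto simp: X_def)
  ultimately have "card (X - C) = 0"
    using C(2) pairing_full[OF full(2) E(2)] pairing_full[OF fullC E(2)] by (simp del: card_0_eq)
  then have XC: "X \<subseteq> C" by simp
  \<comment> \<open>Of \<open>M\<close> the set \<open>B\<close> misses only \<open>a\<close>, so
    \<open>g M\<close> is at least \<open>card M - 2\<close> and the tight set \<open>C\<close>
    misses at most one element.\<close>
  have "pairing M B \<le> g M" using B(1) M by (simp add: feasible_def)
  moreover have "M - B = {a}" using a by (auto simp: M_def)
  ultimately have MC: "card (M - C) \<le> 1"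
    using C(3) pairing_full[OF full(1) E(1)] pairing_full[OF fullC E(1)] by simp
  have CE: "x \<in> E \<times> UNIV" if "x \<in> C" for x
    using that full_setsD_AdS[OF fullC] by (auto simp: AdS_def)
  have barC: "bar x \<in> B" "bar x \<notin> C" if "x \<in> C - B" for x
    using that full_sets_bar[OF full(1) CE] full_sets_bar[OF fullC CE] by auto
  \<comment> \<open>\<open>M\<close> is \<open>B\<close> with the sign at the index of
    \<open>a\<close> flipped. Any other flip from \<open>B\<close> to \<open>C\<close> is thus one
    from \<open>M\<close> to \<open>C\<close>.\<close>
  have "C - B \<subseteq> insert a (bar ` (M - C))"
  proof
    fix x assume x: "x \<in> C - B"
    then show "x \<in> insert a (bar ` (M - C))"
      using barC[OF x] by (auto simp: M_def)
  qed
  then have "card (C - B) \<le> card (insert a (bar ` (M - C)))" by (intro card_mono) auto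
  also have "\<dots> \<le> Suc (card (bar ` (M - C)))" by (simp add: card_insert_if)
  also have "\<dots> \<le> 2" using MC by (simp add: card_image)
  finally have "card (C - B) \<le> 2" .
  moreover have "C - B \<subseteq> B' - B"
  proof
    fix x assume x: "x \<in> C - B"
    then have "bar x \<notin> B'" using barC[OF x] XC by (auto simp: X_def)
    then show "x \<in> B' - B" using x full_sets_bar[OF full(2) CE, of x] by auto
  qed
  moreover have "a \<in> C" using XC by (simp add: X_def)
  ultimately show ?thesis using that C(1) by blast
qed

text \<open>Exchanging at \<open>a\<close> flips at most one further index, whose weight cannot
  outweigh that of \<open>a\<close>. The resulting \<open>C\<close> is therefore again a maximiser
  of \<open>u\<close>, so its difference from \<open>B\<close> is a non-zero multiple of the edge
  direction and has the same support.\<close>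

lemma edge_card_le_2_aux:
  assumes B: "B \<in> feasible" "B' \<in> feasible" and a: "a \<in> B' - B"
    and max: "\<And>C. C \<in> feasible \<Longrightarrow> u \<bullet> eS C \<le> u \<bullet> eS B"
    and par: "\<And>C. C \<in> feasible \<Longrightarrow> u \<bullet> eS C = u \<bullet> eS B \<Longrightarrow>
      \<exists>c. eS C - eS B = c *\<^sub>R (eS B' - eS B)"
    and dom: "\<And>x. x \<in> B' - B \<Longrightarrow> \<bar>u \<bullet> evec x\<bar> \<le> u \<bullet> evec a"
  shows "card (B' - B) \<le> 2"
proof -
  obtain C where C: "C \<in> feasible" "a \<in> C" "C - B \<subseteq> B' - B" "card (C - B) \<le> 2"
    using feasible_exchange[OF B a] .
  have full: "B \<in> full_sets E" "B' \<in> full_sets E" "C \<in> full_sets E"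
    using B C(1) by (auto simp: feasible_def)
  have aC: "a \<in> C - B" using a C(2) by simp
  then have "card (C - B - {a}) \<le> 1" using C(4) by simp
  then consider "C - B - {a} = {}" | x where "C - B - {a} = {x}"
    by (metis One_nat_def card_0_eq card_1_singletonE finite le_Suc_eq le_zero_eq)
  then have "\<bar>\<Sum>x\<in>C - B - {a}. u \<bullet> evec x\<bar> \<le> u \<bullet> evec a"
  proof cases
    case 1
    then show ?thesis using dom[OF a] by (simp only: sum.empty)
  next
    case 2
    then have "x \<in> B' - B" using C(3) by blast
    then show ?thesis using 2 dom by simp
  qed
  moreover have "u \<bullet> eS (C - B) = u \<bullet> evec a + (\<Sum>x\<in>C - B - {a}. u \<bullet> evec x)"
    unfolding eS_def inner_sum_right using aC by (simp add: sum.remove)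
  moreover have "u \<bullet> eS C - u \<bullet> eS B = 2 * (u \<bullet> eS (C - B))"
    using eS_diff_eq[OF full(1,3)] by (metis inner_diff_right inner_scaleR_right)
  ultimately have "u \<bullet> eS C = u \<bullet> eS B" using max[OF C(1)] by linarith
  then obtain c where c: "eS C - eS B = c *\<^sub>R (eS B' - eS B)" using par C(1) by blast
  have "C \<noteq> B" using aC by blast
  then have "c \<noteq> 0" using c eS_inj_full[OF full(1,3)] by auto
  then have "card (C - B) = card (B' - B)"
    using card_diff_eq_support[OF full(1,3)] card_diff_eq_support[OF full(1,2)] c by simp
  then show ?thesis using C(4) by simp
qed

text \<open>Exchanging an index where \<open>u\<close> is largest in absolute value, from the endpoint of the edge
  at which this index does not decrease \<open>u\<close>, yields a further maximiser of \<open>u\<close>.\<close>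

lemma edge_card_le_2:
  assumes B: "B \<in> feasible" "B' \<in> feasible" "B \<noteq> B'"
    and e: "eS B \<in> e" "eS B' \<in> e"
    and par: "\<And>x y. x \<in> e \<Longrightarrow> y \<in> e \<Longrightarrow> \<exists>c. x - y = c *\<^sub>R (eS B' - eS B)"
    and u: "u \<bullet> eS B' = u \<bullet> eS B" "\<And>C. C \<in> feasible \<Longrightarrow> u \<bullet> eS C \<le> u \<bullet> eS B"
    and mem: "\<And>C. C \<in> feasible \<Longrightarrow> u \<bullet> eS C = u \<bullet> eS B \<Longrightarrow> eS C \<in> e"
  shows "card (B' - B) \<le> 2"
proof -
  have full: "B \<in> full_sets E" "B' \<in> full_sets E" using B by (auto simp: feasible_def)
  let ?w = "\<lambda>x. \<bar>u \<bullet> evec x\<bar>"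
  have "Max (?w ` (B' - B)) \<in> ?w ` (B' - B)"
    using full_sets_diff_nonempty[OF full B(3)] by (intro Max_in) auto
  then obtain a where a: "a \<in> B' - B" "Max (?w ` (B' - B)) = ?w a" by blast
  have dom: "?w x \<le> ?w a" if "x \<in> B' - B" for x
    unfolding a(2)[symmetric] using that by (intro Max_ge) auto
  show ?thesis
  proof (cases "u \<bullet> evec a \<ge> 0")
    case True
    show ?thesis
    proof (rule edge_card_le_2_aux[OF B(1,2) a(1) u(2)])
      show "\<exists>c. eS C - eS B = c *\<^sub>R (eS B' - eS B)"
        if "C \<in> feasible" "u \<bullet> eS C = u \<bullet> eS B" for C
        using par[OF mem[OF that] e(1)] .
    qed (use dom True in auto)
  next
    case False
    have diff: "B - B' = bar ` (B' - B)" by (rule full_sets_diff_bar[OF full])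
    have bara: "bar a \<in> B - B'" using a(1) unfolding diff by simp
    have "card (B - B') \<le> 2"
    proof (rule edge_card_le_2_aux[OF B(2,1) bara])
      show "u \<bullet> eS C \<le> u \<bullet> eS B'" if "C \<in> feasible" for C using u that by simp
      show "\<exists>c. eS C - eS B' = c *\<^sub>R (eS B - eS B')"
        if C: "C \<in> feasible" "u \<bullet> eS C = u \<bullet> eS B'" for C
      proof -
        obtain c where "eS C - eS B' = c *\<^sub>R (eS B' - eS B)"
          using par[OF mem e(2)] C u(1) by auto
        then have "eS C - eS B' = (- c) *\<^sub>R (eS B - eS B')" by (simp add: algebra_simps)
        then show ?thesis by blast
      qed
      show "?w x \<le> u \<bullet> evec (bar a)" if "x \<in> B - B'" for x
      proof -
        have "bar x \<in> B' - B" using that unfolding diff by simp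
        from dom[OF this] show ?thesis using False by (simp add: evec_bar)
      qed
    qed
    then show ?thesis using full_sets_diff_card[OF full] by simp
  qed
qed

lemma delta_matroid_feasible: "delta_matroid E feasible"
proof -
  have "\<exists>v\<in>dm_dirs E. parallel_to e v" if edge: "is_edge (polytope_of feasible) e" for e
  proof -
    from edge_vertices[OF feasible_full edge] obtain B B' u where
      B: "B \<in> feasible" "B' \<in> feasible" "B \<noteq> B'"
      and e: "eS B \<in> e" "eS B' \<in> e"
      and par: "\<And>x y. x \<in> e \<Longrightarrow> y \<in> e \<Longrightarrow> \<exists>c. x - y = c *\<^sub>R (eS B' - eS B)"
      and u: "u \<bullet> eS B' = u \<bullet> eS B" "\<And>C. C \<in> feasible \<Longrightarrow> u \<bullet> eS C \<le> u \<bullet> eS B"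
      and mem: "\<And>C. C \<in> feasible \<Longrightarrow> u \<bullet> eS C = u \<bullet> eS B \<Longrightarrow> eS C \<in> e"
      by blast
    have full: "B \<in> full_sets E" "B' \<in> full_sets E" using B by (auto simp: feasible_def)
    have "card (B' - B) \<le> 2" by (rule edge_card_le_2[OF B e par u mem])
    moreover have "card (B' - B) \<noteq> 0" using full_sets_diff_nonempty[OF full B(3)] by simp
    ultimately consider "card (B' - B) = 1" | "card (B' - B) = 2" by linarith
    then obtain v k where "v \<in> dm_dirs E" "eS B' - eS B = k *\<^sub>R v"
    proof cases
      case 1
      from eS_diff_dm_dirs[OF full 1] show ?thesis using that by blast
    next
      case 2
      from eS_diff_even_dirs[OF full 2] show ?thesis using that even_dirs_subset by blast
    qed
    then show ?thesis using parallel_to_multiple[of e, OF par] by blast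
  qed
  then show ?thesis
    using feasible_full feasible_nonempty unfolding delta_matroid_def full_sets_def by blast
qed

end

section \<open>Even delta-matroids\<close>

text \<open>This lets \<open>pairing_full\<close>, which needs a full second argument, evaluate
  pairings whose first argument is full.\<close>

lemma pairing_commute:
  fixes S :: "('a::finite \<times> bool) set"
  shows "pairing S B = pairing B S"
  using eS_inner_eS[of S B] eS_inner_eS[of B S] by (simp add: inner_commute)

text \<open>Edges improving the inner product with \<open>eS B0\<close> lead from \<open>B\<close>
  towards \<open>B0\<close>. Each flips exactly two indices and so preserves the parity of the
  distance to \<open>B0\<close>, while the distance drops strictly.\<close>

lemma even_dm_even_diff:
  fixes E :: "'a::finite set"
  assumes ev: "even_dm E F" and "B \<in> F" "B0 \<in> F"
  shows "even (card (B0 - B))"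
  using assms(2)
proof (induction "card (B0 - B)" arbitrary: B rule: less_induct)
  case less
  have F: "F \<subseteq> full_sets E" using ev delta_matroid_full by (auto simp: even_dm_def)
  have full: "B \<in> full_sets E" "B0 \<in> full_sets E" using F less.prems assms(3) by auto
  have B0E: "B0 \<subseteq> E \<times> UNIV" using full by (simp add: full_sets_def AdS_def)
  show ?case
  proof (cases "B = B0")
    case False
    then have "card (B0 - B) > 0"
      using full_sets_diff_nonempty[OF full] by (simp add: card_gt_0_iff)
    then have "eS B0 \<bullet> eS B < eS B0 \<bullet> eS B0"
      using full B0E by (simp add: eS_inner_eS pairing_full)
    from improving_edge[OF F less.prems assms(3) this] obtain B' e where B':
      "B' \<in> F" "eS B0 \<bullet> eS B < eS B0 \<bullet> eS B'" "eS B \<in> e" "eS B' \<in> e"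
      "is_edge (polytope_of F) e" .
    obtain v where v: "v \<in> even_dirs E" "parallel_to e v"
      using ev B'(5) unfolding even_dm_def by blast
    have full': "B' \<in> full_sets E" using B'(1) F by blast
    have "B \<noteq> B'" using B'(2) by auto
    then have "card (B' - B) = 2"
      using card_diff_eq_2_if_parallel[OF full(1) full' B'(3,4) v] by blast
    moreover have "B' - B \<subseteq> E \<times> UNIV" using full' by (auto simp: full_sets_def AdS_def)
    ultimately have "pairing B0 B' - pairing B0 B = 2 * (2 - 2 * int (card (B' - B - B0)))"
      using pairing_diff[OF full(1) full'] pairing_commute[of B0 "B' - B"]
        pairing_full[OF full(2), of "B' - B"] by simp
    \<comment> \<open>Each of the two flips lowers the distance to \<open>B0\<close> by one if the
      new element lies in \<open>B0\<close>, and raises it by one otherwise.\<close>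
    then have eq: "int (card (B0 - B)) - int (card (B0 - B')) = 2 - 2 * int (card (B' - B - B0))"
      using pairing_full[OF full(1) B0E] pairing_full[OF full' B0E] by simp
    have "card (B0 - B') < card (B0 - B)"
      using B'(2) pairing_full[OF full(1) B0E] pairing_full[OF full' B0E] by (simp add: eS_inner_eS)
    from less.hyps[OF this B'(1)] show ?thesis using eq by presburger
  qed simp
qed

text \<open>Each flipped index changes the pairing with a full set by 2 or -2, and the number of
  flips is even.\<close>

lemma even_dm_pairing_mod_4:
  fixes E :: "'a::finite set"
  assumes ev: "even_dm E F" and B: "B \<in> F" "B' \<in> F" and M: "M \<in> full_sets E"
  shows "4 dvd pairing M B' - pairing M B"
proof -
  have F: "F \<subseteq> full_sets E" using ev delta_matroid_full by (auto simp: even_dm_def)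
  have full: "B \<in> full_sets E" "B' \<in> full_sets E" using F B by auto
  have "B' - B \<subseteq> E \<times> UNIV" using full by (auto simp: full_sets_def AdS_def)
  then have "pairing M B' - pairing M B
      = 2 * (int (card (B' - B)) - 2 * int (card (B' - B - M)))"
    using pairing_diff[OF full, of M] pairing_commute[of M "B' - B"] pairing_full[OF M, of "B' - B"]
    by simp
  then show ?thesis using even_dm_even_diff[OF ev B] by presburger
qed

text \<open>At a common maximiser of \<open>S\<close> and \<open>insert a S\<close> the two ranks
  differ by the sign of \<open>a\<close>, which is non-zero since the maximiser is full.\<close>

lemma dm_rank_insert:
  fixes E :: "'a::finite set"
  assumes dm: "delta_matroid E F" and a: "a \<notin> S" "insert a S \<in> AdS E"
  shows "dm_rank F (insert a S) - dm_rank F S \<in> {1, -1}"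
proof -
  obtain B where B: "B \<in> F" "dm_rank F S = pairing S B"
    "dm_rank F (insert a S) = pairing (insert a S) B"
    using common_maximiser[OF dm subset_insertI a(2)] .
  moreover have "a \<in> E \<times> UNIV" using a(2) by (auto simp: AdS_def)
  then have "sg B a \<in> {1, -1}"
    using sg_full[of B E a] subsetD[OF delta_matroid_full[OF dm] B(1)] by simp
  ultimately show ?thesis using pairing_insert[OF a(1)] by simp
qed

text \<open>Both ranks on the right differ from \<open>dm_rank F S\<close> by exactly one, so it
  suffices that they are different.\<close>

lemma even_dm_rank_average:
  fixes E :: "'a::finite set"
  assumes ev: "even_dm E F" and S: "S \<in> AdS E" "card S = card E - 1"
    and i: "i \<in> E" "(i, True) \<notin> S" "(i, False) \<notin> S"
  shows "2 * dm_rank F S = dm_rank F (S \<union> {(i, True)}) + dm_rank F (S \<union> {(i, False)})"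
proof -
  have dm: "delta_matroid E F" using ev by (simp add: even_dm_def)
  have F: "F \<noteq> {}" using dm by (simp add: delta_matroid_def)
  let ?a = "(i, True)" and ?b = "(i, False)"
  \<comment> \<open>This makes the truncated subtraction in \<open>card S = card E - 1\<close>
    exact.\<close>
  have "card E > 0" using i(1) by (auto simp: card_gt_0_iff)
  then have full: "insert ?a S \<in> full_sets E" "insert ?b S \<in> full_sets E"
    using S i by (auto simp: full_sets_def AdS_def)
  have "dm_rank F (insert ?a S) \<noteq> dm_rank F (insert ?b S)"
  proof
    assume eq: "dm_rank F (insert ?a S) = dm_rank F (insert ?b S)"
    obtain A where A: "A \<in> F" "dm_rank F (insert ?a S) = pairing (insert ?a S) A"
      using dm_rank_attained[OF F] .
    obtain B where B: "B \<in> F" "dm_rank F (insert ?b S) = pairing (insert ?b S) B"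
      using dm_rank_attained[OF F] .
    have "4 dvd pairing (insert ?b S) B - pairing (insert ?b S) A"
      by (rule even_dm_pairing_mod_4[OF ev A(1) B(1) full(2)])
    \<comment> \<open>If the two ranks agreed, this difference of 2 or -2 would be the one just
      shown to be divisible by 4.\<close>
    moreover have "pairing (insert ?a S) A - pairing (insert ?b S) A = 2 * sg A ?a"
      using pairing_insert[OF i(2)] pairing_insert[OF i(3)] sg_bar[of A ?a] by (simp add: bar_def)
    moreover have "sg A ?a \<in> {1, -1}"
      using sg_full[of A E ?a] subsetD[OF delta_matroid_full[OF dm] A(1)] i(1) by simp
    ultimately show False using eq A(2) B(2) by auto
  qed
  moreover have "dm_rank F (insert ?a S) - dm_rank F S \<in> {1, -1}"
    "dm_rank F (insert ?b S) - dm_rank F S \<in> {1, -1}"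
    using dm_rank_insert[OF dm] full i by (auto simp: full_sets_def)
  ultimately show ?thesis by auto
qed

text \<open>An edge flipping a single index would join two members of \<open>F\<close> with common
  part \<open>S\<close>. Both have rank at least \<open>card E\<close>, so their average exceeds the
  bound \<open>card E - 1\<close> on the rank of \<open>S\<close>.\<close>

lemma even_dm_if_rank_average:
  fixes E :: "'a::finite set"
  assumes dm: "delta_matroid E F"
    and avg: "\<And>S i. S \<in> AdS E \<Longrightarrow> card S = card E - 1 \<Longrightarrow> i \<in> E \<Longrightarrow> (i, True) \<notin> S \<Longrightarrow>
      (i, False) \<notin> S \<Longrightarrow>
      2 * dm_rank F S = dm_rank F (S \<union> {(i, True)}) + dm_rank F (S \<union> {(i, False)})"
  shows "even_dm E F"
proof -
  have F: "F \<subseteq> full_sets E" "F \<noteq> {}"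
    using dm delta_matroid_full by (auto simp: delta_matroid_def)
  have "\<exists>v\<in>even_dirs E. parallel_to e v" if edge: "is_edge (polytope_of F) e" for e
  proof -
    from edge_vertices[OF F(1) edge] obtain B B' u where
      B: "B \<in> F" "B' \<in> F" "B \<noteq> B'"
      and e: "eS B \<in> e" "eS B' \<in> e"
      and par: "\<And>x y. x \<in> e \<Longrightarrow> y \<in> e \<Longrightarrow> \<exists>c. x - y = c *\<^sub>R (eS B' - eS B)"
      and "u \<bullet> eS B' = u \<bullet> eS B" "\<And>C. C \<in> F \<Longrightarrow> u \<bullet> eS C \<le> u \<bullet> eS B"
        "\<And>C. C \<in> F \<Longrightarrow> u \<bullet> eS C = u \<bullet> eS B \<Longrightarrow> eS C \<in> e"
      by blast
    have full: "B \<in> full_sets E" "B' \<in> full_sets E" using B F by auto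
    obtain v where "v \<in> dm_dirs E" "parallel_to e v"
      using dm edge unfolding delta_matroid_def by blast
    then have "card (B' - B) \<le> 2" using card_diff_le_2_if_parallel[OF full e] by blast
    moreover have "card (B' - B) \<noteq> 0" using full_sets_diff_nonempty[OF full B(3)] by simp
    moreover have "card (B' - B) \<noteq> 1"
    proof
      assume "card (B' - B) = 1"
      then obtain a where a: "B' - B = {a}" by (auto simp: card_1_singleton_iff)
      then have bara: "B - B' = {bar a}" using full_sets_diff_bar[OF full] by simp
      define S where "S = B \<inter> B'"
      have ins: "B' = insert a S" "B = insert (bar a) S" using a bara by (auto simp: S_def)
      have notin: "a \<notin> S" "bar a \<notin> S" using a bara by (auto simp: S_def)
      have S: "S \<in> AdS E"
        by (rule AdS_subset[OF full_setsD_AdS[OF full(1)]]) (simp add: S_def)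
      have "card (insert a S) = card E" using full(2) ins by (simp add: full_sets_def)
      then have card: "card S + 1 = card E" using notin by simp
      have aE: "fst a \<in> E" using a full_setsD_AdS[OF full(2)] by (auto simp: AdS_def)
      have or: "a = (fst a, True) \<and> bar a = (fst a, False) \<or>
          a = (fst a, False) \<and> bar a = (fst a, True)"
        by (cases a) (auto simp: bar_def)
      then have "2 * dm_rank F S = dm_rank F (S \<union> {(fst a, True)}) + dm_rank F (S \<union> {(fst a, False)})"
        using S card aE notin by (intro avg) auto
      moreover have "dm_rank F (S \<union> {(fst a, True)}) + dm_rank F (S \<union> {(fst a, False)})
          = dm_rank F B' + dm_rank F B"
        using or unfolding ins by (metis Un_insert_right add.commute sup_bot_right)
      moreover have full_rank: "int (card E) \<le> dm_rank F C" if C: "C \<in> F" for C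
      proof -
        have fullC: "C \<in> full_sets E" using C F(1) by blast
        then have "C \<subseteq> E \<times> UNIV" "card C = card E" by (auto simp: full_sets_def AdS_def)
        then have "pairing C C = int (card E)" using pairing_full[OF fullC, of C] by simp
        then show ?thesis using pairing_le_dm_rank[OF C, of C] by simp
      qed
      ultimately show False
        using full_rank[OF B(1)] full_rank[OF B(2)] dm_rank_abs_le[OF F S] card by linarith
    qed
    ultimately have "card (B' - B) = 2" by linarith
    then obtain v k where "v \<in> even_dirs E" "eS B' - eS B = k *\<^sub>R v"
      using eS_diff_even_dirs[OF full] by blast
    then show ?thesis using parallel_to_multiple[of e, OF par] by blast
  qed
  then show ?thesis using dm by (simp add: even_dm_def)
qed

lemma of_int_eq_average_iff:
  "real_of_int x = (real_of_int y + real_of_int z) / 2 \<longleftrightarrow> 2 * x = y + z"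
  by (simp add: eq_divide_eq mult.commute flip: of_int_add of_int_eq_iff[where 'a = real])

theorem theorem1p2:
  fixes E :: "'a::finite set"
  shows "(\<forall>g :: ('a \<times> bool) set \<Rightarrow> int.
      (\<exists>F. delta_matroid E F \<and> (\<forall>S\<in>AdS E. g S = dm_rank F S)) \<longleftrightarrow>
      (g {} = 0 \<and>
       (\<forall>S\<in>AdS E. card S = 1 \<longrightarrow> \<bar>g S\<bar> \<le> 1) \<and>
       (\<forall>S\<in>AdS E. \<forall>T\<in>AdS E. g S + g T \<ge> g (S \<inter> T) + g (sqcup S T)) \<and>
       (\<forall>S\<in>AdS E. g S mod 2 = int (card S) mod 2)))
    \<and>
    (\<forall>F. delta_matroid E F \<longrightarrow>
      (even_dm E F \<longleftrightarrow>
        (\<forall>S\<in>AdS E. \<forall>i\<in>E. card S = card E - 1 \<longrightarrow> (i, True) \<notin> S \<longrightarrow> (i, False) \<notin> S \<longrightarrow>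
           real_of_int (dm_rank F S) =
             (real_of_int (dm_rank F (S \<union> {(i, True)})) + real_of_int (dm_rank F (S \<union> {(i, False)}))) / 2)))"
proof (intro conjI allI impI)
  fix g :: "('a \<times> bool) set \<Rightarrow> int"
  show "(\<exists>F. delta_matroid E F \<and> (\<forall>S\<in>AdS E. g S = dm_rank F S)) \<longleftrightarrow>
      (g {} = 0 \<and>
       (\<forall>S\<in>AdS E. card S = 1 \<longrightarrow> \<bar>g S\<bar> \<le> 1) \<and>
       (\<forall>S\<in>AdS E. \<forall>T\<in>AdS E. g S + g T \<ge> g (S \<inter> T) + g (sqcup S T)) \<and>
       (\<forall>S\<in>AdS E. g S mod 2 = int (card S) mod 2))" (is "?L \<longleftrightarrow> ?R")
  proof
    assume ?L
    then obtain F where dm: "delta_matroid E F" and g: "\<And>S. S \<in> AdS E \<Longrightarrow> g S = dm_rank F S"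
      by blast
    have F: "F \<subseteq> full_sets E" "F \<noteq> {}"
      using dm delta_matroid_full by (auto simp: delta_matroid_def)
    show ?R
    proof (intro conjI ballI impI)
      have "{} \<in> AdS E" by (simp add: AdS_def)
      then show "g {} = 0" using g dm_rank_empty[OF F(2)] by simp
      show "\<bar>g S\<bar> \<le> 1" if "S \<in> AdS E" "card S = 1" for S
        using dm_rank_abs_le[OF F that(1)] g that by simp
      show "g S mod 2 = int (card S) mod 2" if "S \<in> AdS E" for S
        using dm_rank_parity[OF F that] g that by simp
      show "g (S \<inter> T) + g (sqcup S T) \<le> g S + g T" if ST: "S \<in> AdS E" "T \<in> AdS E" for S T
        using dm_rank_bisubmodular[OF dm ST] g ST sqcup_AdS[OF ST] AdS_subset[OF ST(1), of "S \<inter> T"]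
        by simp
    qed
  next
    assume ?R
    \<comment> \<open>The witness is the family \<open>feasible\<close> attached to
      \<open>g\<close>.\<close>
    then interpret signed_rank E g by unfold_locales blast+
    show ?L using delta_matroid_feasible dm_rank_feasible by metis
  qed
next
  fix F :: "('a \<times> bool) set set" assume dm: "delta_matroid E F"
  show "even_dm E F \<longleftrightarrow>
        (\<forall>S\<in>AdS E. \<forall>i\<in>E. card S = card E - 1 \<longrightarrow> (i, True) \<notin> S \<longrightarrow> (i, False) \<notin> S \<longrightarrow>
           real_of_int (dm_rank F S) =
             (real_of_int (dm_rank F (S \<union> {(i, True)})) + real_of_int (dm_rank F (S \<union> {(i, False)}))) / 2)"
    unfolding of_int_eq_average_iff
    using even_dm_rank_average even_dm_if_rank_average[OF dm] by blast
qed

end
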